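(* Let $d\ge1$ be an integer and let $\mu$ be a probability distribution on $\mathbb R^d$. Then $\mu$ is a multivariate Vervaat perpetuity if and only if $\mu=L^*_1(\nu,0)$ for some finite Borel measure $\nu$ on $\mathbb R^d$ satisfying $\nu(\{0\})=0$ and $\int_{|x|>2}\log|x|\,\nu(\mathrm dx)<\infty$.
   Context: Multivariate Vervaat perpetuity (MVP): the distribution of a random variable $X$ on $\mathbb R^d$ is MVP if there exist $\theta>0$ and a probability measure $\nu_1$ on $\mathbb R^d$ with $\int_{|x|>2}\log|x|\,\nu_1(\mathrm dx)<\infty$ such that $$X\stackrel{d}{=}U^{1/\theta}(X+Z),$$ where $Z\sim\nu_1$, $U$ is uniform on $(0,1)$, and $U,X,Z$ are independent on the right side. ($\nu_1$ may have an atom at $0$.) For a finite Borel measure $\nu$ on $\mathbb R^d$ with $\nu(\{0\})=0$ and $\int_{|x|>2}\log|x|\,\nu(\mathrm dx)<\infty$ and for $\gamma\in\mathbb R^d$, $L^*_1(\nu,\gamma)$ denotes the infinitely divisible distribution on $\mathbb R^d$ with characteristic function $$z\mapsto\exp\left\{i\langle\gamma,z\rangle+\int_{\mathbb R^d}\int_0^1\left(e^{ir\langle z,y\rangle}-1\right)r^{-1}\,\mathrm dr\,\nu(\mathrm dy)\right\}.$$ This is the distribution with no Gaussian part, drift $\gamma$, and Lévy measure $M_1(B)=\int_{\mathbb R^d}\int_0^1 1_B(yr)r^{-1}\,\mathrm dr\,\nu(\mathrm dy)$. *)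

theory Defs
  imports "HOL-Probability.Probability"
begin

definition borel_measure :: "'a::euclidean_space measure \<Rightarrow> bool" where
  "borel_measure \<nu> \<longleftrightarrow> sets \<nu> = sets borel"

definition log_moment :: "'a::euclidean_space measure \<Rightarrow> bool" where
  "log_moment \<nu> \<longleftrightarrow>
     (\<integral>\<^sup>+x\<in>{x. norm x > 2}. ennreal (ln (norm x)) \<partial>\<nu>) < \<infinity>"

text \<open>
  The distributional fixed-point equation involves only the joint law of the independent
  variables \<open>U\<close>, \<open>X\<close>, \<open>Z\<close>, so they are taken as the coordinates of a product space; the
  first coordinate is uniform on \<open>(0,1)\<close> and the second one has the law \<open>\<mu>\<close> itself.
\<close>
definition MVP :: "'a::euclidean_space measure \<Rightarrow> bool" where
  "MVP \<mu> \<longleftrightarrow>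
     prob_space \<mu> \<and> borel_measure \<mu> \<and>
     (\<exists>\<theta>>0. \<exists>\<nu>\<^sub>1 :: 'a measure.
        prob_space \<nu>\<^sub>1 \<and> borel_measure \<nu>\<^sub>1 \<and> log_moment \<nu>\<^sub>1 \<and>
        \<mu> = distr (uniform_measure lborel {0<..<1::real} \<Otimes>\<^sub>M (\<mu> \<Otimes>\<^sub>M \<nu>\<^sub>1)) borel
              (\<lambda>(u, x, z). (u powr (1 / \<theta>)) *\<^sub>R (x + z)))"

text \<open>The library's \<^const>\<open>char\<close> covers only measures on the real line.\<close>
definition char_fun :: "'a::euclidean_space measure \<Rightarrow> 'a \<Rightarrow> complex" where
  "char_fun \<mu> z = (CLINT x|\<mu>. iexp (z \<bullet> x))"

text \<open>
  \<open>is_Lstar1 \<nu> \<gamma> \<mu>\<close> means \<open>\<mu> = L\<^sup>*\<^sub>1(\<nu>, \<gamma>)\<close>; a Borel probability measure on a Euclidean space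
  is determined by its characteristic function. For finite \<open>\<nu>\<close> with \<open>log_moment \<nu>\<close>
  both integrals converge absolutely: the inner integrand is bounded, and the
  inner integral grows at most logarithmically in \<open>norm y\<close>.
\<close>
definition is_Lstar1 ::
    "'a::euclidean_space measure \<Rightarrow> 'a \<Rightarrow> 'a measure \<Rightarrow> bool" where
  "is_Lstar1 \<nu> \<gamma> \<mu> \<longleftrightarrow>
     prob_space \<mu> \<and> borel_measure \<mu> \<and>
     (\<forall>z. char_fun \<mu> z =
        exp (\<i> * complex_of_real (\<gamma> \<bullet> z) +
          (CLINT y|\<nu>. (CLINT r:{0<..<1::real}|lborel.
             (iexp (r * (z \<bullet> y)) - 1) / complex_of_real r))))"

end

theory Submission imports Defs begin

text \<open>
  Fix \<open>z\<close> and write \<open>p w\<close>, \<open>q w\<close> for the characteristic functions of \<open>\<mu>\<close> and \<open>\<nu>\<^sub>1\<close> at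
  \<open>w\<^bsup>1/\<theta>\<^esup> z\<close>. Since \<open>U\<close> is uniform, the perpetuity equation on the ray through \<open>z\<close> says
  \<open>w p(w) = \<integral>\<^sub>0\<^sup>w p q\<close>, that is \<open>p' = p (q - 1) / w\<close> with \<open>p(0) = 1\<close>. The logarithmic moment makes
  \<open>(q - 1) / w\<close> integrable at \<open>0\<close>, so the equation is equivalent to
  \<open>p(1) = exp (\<integral>\<^sub>0\<^sup>1 (q - 1) / w dw)\<close>, and by Fubini this exponent is the one of \<open>L\<^sup>*\<^sub>1(\<theta> \<nu>\<^sub>1, 0)\<close>; an
  atom of \<open>\<nu>\<^sub>1\<close> at \<open>0\<close> contributes nothing to it. Fourier uniqueness in several dimensions is reduced
  to Levy's theorem on the line by fixing the coordinates of a box one at a time.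
\<close>

subsection \<open>Fourier uniqueness on Euclidean spaces\<close>

lemma integrable_bounded_finite:
  fixes f :: "'a \<Rightarrow> 'b::{banach,second_countable_topology}"
  assumes "finite_measure M" "f \<in> borel_measurable M" "\<And>x. norm (f x) \<le> C"
  shows "integrable M f"
  using finite_measure.integrable_const_bound[OF assms(1), of f C] assms by auto

text \<open>The characteristic function at 0 is the total mass, so both measures have the same mass
  \<open>m\<close>. If \<open>m\<close> is positive, dividing by it reduces the claim to Levy's
  theorem for probability distributions; if it is 0, both measures vanish.\<close>

lemma finite_measure_eqI_char:
  fixes M N :: "real measure"
  assumes fin: "finite_measure M" "finite_measure N"
    and sets: "sets M = sets borel" "sets N = sets borel"
    and eq: "\<And>t. char M t = char N t"
  shows "M = N"
proof -
  define m where "m = measure M UNIV"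
  have sp: "space M = UNIV" "space N = UNIV"
    using sets_eq_imp_space_eq[OF sets(1)] sets_eq_imp_space_eq[OF sets(2)] by auto
  have mN: "measure N UNIV = m"
    using eq[of 0] by (simp add: char_def m_def sp)
  have em: "emeasure M UNIV = ennreal m" "emeasure N UNIV = ennreal m"
    using fin by (auto simp: m_def mN[unfolded m_def, symmetric] finite_measure.emeasure_eq_measure)
  show ?thesis
  proof (cases "m = 0")
    case True
    then have "emeasure M X = 0" "emeasure N X = 0" for X
      using em emeasure_space[of M X] emeasure_space[of N X] by (auto simp: sp)
    then show ?thesis using sets by (intro measure_eqI) auto
  next
    case False
    then have m: "m > 0" by (simp add: m_def zero_less_measure_iff)
    have D: "real_distribution (density K (\<lambda>_. ennreal (1/m)))"
      "char (density K (\<lambda>_. ennreal (1/m))) t = char K t / m"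
      if "sets K = sets borel" "emeasure K UNIV = ennreal m" for K :: "real measure" and t
    proof -
      have sK: "space K = UNIV" using sets_eq_imp_space_eq[OF that(1)] by simp
      have "emeasure (density K (\<lambda>_. ennreal (1/m))) (space (density K (\<lambda>_. ennreal (1/m)))) = 1"
        using m that sK by (simp add: emeasure_density_const ennreal_mult'[symmetric])
      then interpret prob_space "density K (\<lambda>_. ennreal (1/m))" by (rule prob_spaceI)
      show "real_distribution (density K (\<lambda>_. ennreal (1/m)))"
        by unfold_locales (use that in auto)
      have "char (density K (\<lambda>_. ennreal (1/m))) t = (CLINT x|K. (1/m) *\<^sub>R iexp (t*x))"
        unfolding char_def using m that(1) by (intro integral_density) (auto cong: measurable_cong_sets)
      then show "char (density K (\<lambda>_. ennreal (1/m))) t = char K t / m"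
        by (simp add: char_def scaleR_conv_of_real divide_inverse mult.commute)
    qed
    have E: "density M (\<lambda>_. ennreal (1/m)) = density N (\<lambda>_. ennreal (1/m))"
      using D sets em eq by (intro Levy_uniqueness ext) auto
    have c: "ennreal m * (ennreal (1/m) * x) = x" for x
      using m by (simp add: mult.assoc[symmetric] ennreal_mult'[symmetric])
    show ?thesis
    proof (rule measure_eqI)
      fix X assume "X \<in> sets M"
      then have "ennreal (1/m) * emeasure M X = ennreal (1/m) * emeasure N X"
        using arg_cong[OF E, of "\<lambda>K. emeasure K X"] sets by (simp add: emeasure_density_const)
      then show "emeasure M X = emeasure N X" using c by metis
    qed (use sets in auto)
  qed
qed

text \<open>Uniqueness on the line needs positive measures, so the phase \<open>iexp (w \<bullet> x)\<close> is carried along in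
  the nonnegative densities \<open>1 + Re (c * iexp (w \<bullet> x))\<close>, with \<open>c\<close> one of \<open>0\<close>, \<open>1\<close>, \<open>-\<i>\<close>.\<close>

lemma fourier_eq_on_slab:
  fixes \<mu> \<nu> :: "'a::euclidean_space measure"
  assumes fin: "finite_measure \<mu>" "finite_measure \<nu>"
    and sets: "sets \<mu> = sets borel" "sets \<nu> = sets borel"
    and B: "B \<in> sets borel" and A: "A \<in> sets borel"
    and eq: "\<And>w. (CLINT x|\<mu>. indicator B x * iexp (w \<bullet> x)) = (CLINT x|\<nu>. indicator B x * iexp (w \<bullet> x))"
  shows "(CLINT x|\<mu>. indicator (B \<inter> {x. x \<bullet> b \<in> A}) x * iexp (w \<bullet> x)) =
    (CLINT x|\<nu>. indicator (B \<inter> {x. x \<bullet> b \<in> A}) x * iexp (w \<bullet> x))"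
proof -
  note [measurable] = B A
  define p :: "complex \<Rightarrow> 'a \<Rightarrow> real" where "p c x = indicator B x * (1 + Re (c * iexp (w \<bullet> x)))" for c x
  have p_meas[measurable]: "p c \<in> borel_measurable borel" for c
    unfolding p_def by measurable
  have re: "\<bar>Re (c * iexp (w \<bullet> x))\<bar> \<le> 1" if "norm c \<le> 1" for c x
    using abs_Re_le_cmod[of "c * iexp (w \<bullet> x)"] that by (simp add: norm_mult)
  have p_nonneg: "p c x \<ge> 0" if "norm c \<le> 1" for c x
    using re[OF that, of x] by (auto simp: p_def indicator_def)
  have p_le: "p c x \<le> 2" if "norm c \<le> 1" for c x
    using re[OF that, of x] by (auto simp: p_def indicator_def)
  \<comment> \<open>\<open>D K c\<close> lives on the line: it is the image of the weighted measure
    under the coordinate along \<open>b\<close>. One-dimensional uniqueness applies to it because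
    the weight \<open>p c\<close> takes values in [0, 2].\<close>
  define D where "D K c = distr (density K (\<lambda>x. ennreal (p c x))) borel (\<lambda>x. x \<bullet> b)" for K c
  have setsD: "sets (D K c) = sets borel" for K c by (simp add: D_def)
  have finD: "finite_measure (D K c)" if "finite_measure K" "sets K = sets borel" "norm c \<le> 1" for K c
  proof -
    have [measurable_cong]: "sets K = sets borel" by fact
    interpret finite_measure K by fact
    have "ennreal (p c x) \<le> 2" for x
      using p_le[OF that(3), of x] ennreal_leI[of "p c x" 2] by simp
    then have "emeasure (density K (\<lambda>x. ennreal (p c x))) (space K) \<le> (\<integral>\<^sup>+x. 2 \<partial>K)"
      by (subst emeasure_density) (auto intro!: nn_integral_mono simp: indicator_def simp del: nn_integral_const)
    also have "\<dots> < \<infinity>" by (simp add: ennreal_mult_less_top less_top[symmetric] ennreal_mult_eq_top_iff)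
    finally have "finite_measure (density K (\<lambda>x. ennreal (p c x)))"
      by (intro finite_measureI) auto
    then show ?thesis unfolding D_def by (rule finite_measure.finite_measure_distr) measurable
  qed
  have intD: "integral\<^sup>L (D K c) h = (CLINT x|K. p c x *\<^sub>R h (x \<bullet> b))"
    if "sets K = sets borel" "norm c \<le> 1" and [measurable]: "h \<in> borel_measurable borel"
    for K c and h :: "real \<Rightarrow> complex"
  proof -
    have [measurable_cong]: "sets K = sets borel" by fact
    show ?thesis unfolding D_def
      using p_nonneg[OF that(2)] by (subst integral_distr) (auto intro!: integral_density)
  qed
  \<comment> \<open>Writing the real part as half the sum of a number and its conjugate turns the
    weight into phases. Only the frequencies \<open>t *\<^sub>R b\<close> and
    \<open>t *\<^sub>R b \<plusminus> w\<close> occur, and \<open>eq\<close> covers all of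
    them.\<close>
  have charD: "char (D K c) t = (CLINT x|K. indicator B x * iexp ((t *\<^sub>R b) \<bullet> x))
      + c/2 * (CLINT x|K. indicator B x * iexp ((t *\<^sub>R b + w) \<bullet> x))
      + cnj c/2 * (CLINT x|K. indicator B x * iexp ((t *\<^sub>R b - w) \<bullet> x))"
    if K: "finite_measure K" "sets K = sets borel" "norm c \<le> 1" for K c t
  proof -
    have [measurable_cong]: "sets K = sets borel" by fact
    have I: "integrable K (\<lambda>x. indicator B x * iexp (v \<bullet> x))" for v
      by (rule integrable_bounded_finite[OF K(1), where C=1]) (auto simp: indicator_def)
    have "p c x *\<^sub>R iexp (t * (x \<bullet> b)) = indicator B x * iexp ((t *\<^sub>R b) \<bullet> x)
      + c/2 * (indicator B x * iexp ((t *\<^sub>R b + w) \<bullet> x))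
      + cnj c/2 * (indicator B x * iexp ((t *\<^sub>R b - w) \<bullet> x))" for x
    proof -
      define E T where "E = iexp (w \<bullet> x)" and "T = iexp ((t *\<^sub>R b) \<bullet> x)"
      have "complex_of_real (Re (c * E)) = (c * E + cnj c * cnj E) / 2"
        using complex_add_cnj[of "c * E"] by simp
      moreover have "cnj E = iexp (- (w \<bullet> x))"
        by (simp add: E_def exp_cnj)
      then have "iexp ((t *\<^sub>R b + w) \<bullet> x) = T * E" "iexp ((t *\<^sub>R b - w) \<bullet> x) = T * cnj E"
        by (simp_all add: E_def T_def inner_add_left inner_diff_left exp_add[symmetric] ring_distribs)
      moreover have "iexp (t * (x \<bullet> b)) = T"
        by (simp add: T_def inner_commute)
      ultimately show ?thesis
        unfolding p_def E_def[symmetric] T_def[symmetric]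
        by (simp add: scaleR_conv_of_real field_simps of_real_indicator del: times_complex.sel)
    qed
    then have "char (D K c) t = (CLINT x|K. indicator B x * iexp ((t *\<^sub>R b) \<bullet> x)
      + c/2 * (indicator B x * iexp ((t *\<^sub>R b + w) \<bullet> x))
      + cnj c/2 * (indicator B x * iexp ((t *\<^sub>R b - w) \<bullet> x)))"
      unfolding char_def using K by (subst intD) auto
    then show ?thesis by (simp add: I I[of "t *\<^sub>R b", simplified])
  qed
  have DD: "D \<mu> c = D \<nu> c" if "norm c \<le> 1" for c
    using that fin sets by (intro finite_measure_eqI_char finD setsD) (simp_all add: charD eq eq[of "t *\<^sub>R b" for t, simplified])
  let ?S = "B \<inter> {x. x \<bullet> b \<in> A}"
  \<comment> \<open>Testing \<open>D K c\<close> against the indicator of \<open>A\<close> brings in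
    the slab condition on the coordinate along \<open>b\<close>.\<close>
  have split: "(CLINT x|K. indicator ?S x + indicator ?S x * of_real (Re (c * iexp (w \<bullet> x)))) = (CLINT x| D K c. indicator A x)"
    if "sets K = sets borel" "norm c \<le> 1" for K c
    using that by (subst intD) (auto intro!: Bochner_Integration.integral_cong simp: p_def indicator_def scaleR_conv_of_real)
  \<comment> \<open>The weight for \<open>c = 0\<close> is the bare indicator of \<open>B\<close>;
    subtracting that case removes the summand 1 from the weight and leaves the oscillating
    part.\<close>
  have key: "(CLINT x|\<mu>. indicator ?S x * of_real (Re (c * iexp (w \<bullet> x)))) =
      (CLINT x|\<nu>. indicator ?S x * of_real (Re (c * iexp (w \<bullet> x))))" if c: "norm c \<le> 1" for c
  proof -
    have I: "integrable K (\<lambda>x. indicator ?S x :: complex)"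
      "integrable K (\<lambda>x. indicator ?S x * complex_of_real (Re (c * iexp (w \<bullet> x))))"
      if "finite_measure K" "sets K = sets borel" for K
    proof -
      have [measurable_cong]: "sets K = sets borel" by fact
      show "integrable K (\<lambda>x. indicator ?S x :: complex)"
        by (rule integrable_bounded_finite[OF that(1), where C=1]) (auto simp: indicator_def)
      show "integrable K (\<lambda>x. indicator ?S x * complex_of_real (Re (c * iexp (w \<bullet> x))))"
        using re[OF c] by (intro integrable_bounded_finite[OF that(1), where C=1]) (auto simp: indicator_def simp del: times_complex.sel)
    qed
    have "(CLINT x|\<mu>. indicator ?S x) = (CLINT x|\<nu>. indicator ?S x :: complex)"
      using split[OF sets(1), of 0] split[OF sets(2), of 0] DD[of 0] by simp
    moreover have "(CLINT x|\<mu>. indicator ?S x + indicator ?S x * of_real (Re (c * iexp (w \<bullet> x)))) =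
      (CLINT x|\<nu>. indicator ?S x + indicator ?S x * of_real (Re (c * iexp (w \<bullet> x))))"
      using split[OF sets(1) c] split[OF sets(2) c] DD[OF c] by simp
    ultimately show ?thesis
      using I[OF fin(1) sets(1)] I[OF fin(2) sets(2)] by (simp del: times_complex.sel)
  qed
  \<comment> \<open>The choices \<open>c = 1\<close> and \<open>c = -\<i>\<close> give the cosine
    and the sine of \<open>w \<bullet> x\<close>, from which the full phase is reassembled.\<close>
  have dec: "(CLINT x|K. indicator ?S x * iexp (w \<bullet> x)) =
      (CLINT x|K. indicator ?S x * of_real (Re (1 * iexp (w \<bullet> x)))) +
      \<i> * (CLINT x|K. indicator ?S x * of_real (Re (- \<i> * iexp (w \<bullet> x))))"
    if "finite_measure K" "sets K = sets borel" for K
  proof -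
    have [measurable_cong]: "sets K = sets borel" by fact
    have I: "integrable K (\<lambda>x. indicator ?S x * complex_of_real (Re (c * iexp (w \<bullet> x))))"
      if "norm c \<le> 1" for c
      using re[OF that] by (intro integrable_bounded_finite[OF \<open>finite_measure K\<close>, where C=1]) (auto simp: indicator_def simp del: times_complex.sel)
    have "(CLINT x|K. indicator ?S x * iexp (w \<bullet> x)) = (CLINT x|K. indicator ?S x * of_real (Re (1 * iexp (w \<bullet> x))) +
      \<i> * (indicator ?S x * of_real (Re (- \<i> * iexp (w \<bullet> x)))))"
      by (intro Bochner_Integration.integral_cong refl) (auto simp: complex_eq_iff indicator_def)
    also have "\<dots> = (CLINT x|K. indicator ?S x * of_real (Re (1 * iexp (w \<bullet> x)))) +
      \<i> * (CLINT x|K. indicator ?S x * of_real (Re (- \<i> * iexp (w \<bullet> x))))"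
      using I[of 1] I[of "-\<i>"] by (subst Bochner_Integration.integral_add) (auto simp del: times_complex.sel)
    finally show ?thesis .
  qed
  show ?thesis
    unfolding dec[OF fin(1) sets(1)] dec[OF fin(2) sets(2)] using key[of 1] key[of "-\<i>"] by simp
qed

text \<open>Restricting one coordinate after another to a Borel set preserves equality of the
  Fourier transforms. With all coordinates restricted to open intervals and frequency 0, the two
  measures agree on open boxes, an intersection-stable generator of the Borel sets.\<close>

theorem char_fun_unique:
  fixes \<mu> \<nu> :: "'a::euclidean_space measure"
  assumes fin: "finite_measure \<mu>" "finite_measure \<nu>"
    and sets: "sets \<mu> = sets borel" "sets \<nu> = sets borel"
    and eq: "\<And>z. char_fun \<mu> z = char_fun \<nu> z"
  shows "\<mu> = \<nu>"
proof -
  \<comment> \<open>The frequency \<open>w\<close> stays arbitrary in the induction, since fixing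
    one more coordinate consumes the equality at all frequencies.\<close>
  have slabs: "(CLINT x|\<mu>. indicator {x. \<forall>b\<in>S. x \<bullet> b \<in> A b} x * iexp (w \<bullet> x)) =
      (CLINT x|\<nu>. indicator {x. \<forall>b\<in>S. x \<bullet> b \<in> A b} x * iexp (w \<bullet> x))"
    if "finite S" "\<And>b. A b \<in> sets borel" for S :: "'a set" and A w
    using that(1)
  proof (induction S arbitrary: w rule: finite_induct)
    case empty
    then show ?case using eq[of w] by (simp add: char_fun_def)
  next
    case (insert b S)
    have B: "{x. \<forall>b\<in>S. x \<bullet> b \<in> A b} \<in> sets borel"
      using insert(1) that(2) by measurable
    have "{x. \<forall>b\<in>insert b S. x \<bullet> b \<in> A b} = {x. \<forall>b\<in>S. x \<bullet> b \<in> A b} \<inter> {x. x \<bullet> b \<in> A b}"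
      by auto
    then show ?case
      using fourier_eq_on_slab[OF fin sets B that(2)[of b] insert.IH] by simp
  qed
  have boxes: "emeasure \<mu> (box u v) = emeasure \<nu> (box u v)" for u v
  proof -
    have "box u v = {x. \<forall>b\<in>Basis. x \<bullet> b \<in> {u \<bullet> b<..<v \<bullet> b}}"
      by (auto simp: box_def)
    then have "(CLINT x|\<mu>. indicator (box u v) x) = (CLINT x|\<nu>. indicator (box u v) x :: complex)"
      using slabs[of Basis "\<lambda>b. {u \<bullet> b<..<v \<bullet> b}" 0] by simp
    moreover have "(CLINT x|K. indicator (box u v) x) = complex_of_real (measure K (box u v))"
      if "finite_measure K" "sets K = sets borel" for K :: "'a measure"
      using sets_eq_imp_space_eq[OF that(2)]
        integral_complex_of_real[of K "indicator (box u v)"] by (simp add: of_real_indicator)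
    ultimately have "measure \<mu> (box u v) = measure \<nu> (box u v)"
      using fin sets by simp
    then show ?thesis
      using fin by (simp add: finite_measure.emeasure_eq_measure)
  qed
  show ?thesis
  proof (rule measure_eqI_generator_eq[where \<Omega>=UNIV and E="range (\<lambda>(a, b). box a b :: 'a set)"
        and A="\<lambda>n. box (- (real n *\<^sub>R One)) (real n *\<^sub>R One)"])
    show "Int_stable (range (\<lambda>(a, b). box a b :: 'a set))"
      by (auto simp: Int_stable_def box_Int_box)
    show "sets \<mu> = sigma_sets UNIV (range (\<lambda>(a, b). box a b))"
      "sets \<nu> = sigma_sets UNIV (range (\<lambda>(a, b). box a b))"
      using sets by (simp_all add: borel_eq_box)
    show "(\<Union>n. box (- (real n *\<^sub>R One)) (real n *\<^sub>R One)) = (UNIV :: 'a set)"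
      by (rule UN_box_eq_UNIV)
  qed (auto simp: boxes finite_measure.emeasure_finite[OF fin(2)])
qed

subsection \<open>The differential equation along a ray\<close>

text \<open>Continuity is asked for only away from 0, because the kernel
  \<open>(q w - 1) / w\<close> may be singular there. At an interior point, integrability together
  with continuity at that point gives the derivative.\<close>

lemma indefinite_integral_deriv:
  fixes k :: "real \<Rightarrow> 'a::banach"
  assumes "k integrable_on {0..1}" "continuous_on {0<..1} k" "0 < s" "s < 1"
  shows "((\<lambda>u. integral {0..u} k) has_vector_derivative k s) (at s)"
proof -
  have "isCont k s"
    using assms continuous_on_interior[of "{0<..1}" k s] by simp
  then have "((\<lambda>u. integral {0..u} k) has_vector_derivative k s) (at s within {0..1} - {})"
    using assms by (intro integral_has_vector_derivative_continuous_at) (auto intro: continuous_at_imp_continuous_at_within)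
  then show ?thesis
    using assms at_within_Icc_at[of 0 s 1] by simp
qed

text \<open>With \<open>H\<close> the integral of the kernel up to \<open>w\<close>, the equation
  makes the derivative of \<open>p w * exp (- H w)\<close> vanish on the open interval. The product
  is continuous on the closed interval, hence constant, and it equals 1 at 0.\<close>

lemma mean_equation_imp_exp:
  fixes p q :: "real \<Rightarrow> complex"
  assumes p: "continuous_on {0..1} p" "p 0 = 1" and q: "continuous_on {0..1} q"
    and k: "(\<lambda>w. (q w - 1) / w) integrable_on {0..1}"
    and eq: "\<And>w. 0 < w \<Longrightarrow> w \<le> 1 \<Longrightarrow> w * p w = integral {0..w} (\<lambda>v. p v * q v)"
  shows "p 1 = exp (integral {0..1} (\<lambda>w. (q w - 1) / w))"
proof -
  define H where "H w = integral {0..w} (\<lambda>w. (q w - 1) / w)" for w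
  define F where "F w = integral {0..w} (\<lambda>v. p v * q v)" for w
  have contH: "continuous_on {0..1} H"
    unfolding H_def by (rule indefinite_integral_continuous_1[OF k])
  have H': "(H has_vector_derivative (q w - 1) / w) (at w)" if "0 < w" "w < 1" for w
    unfolding H_def using that q
    by (intro indefinite_integral_deriv k) (auto intro!: continuous_intros elim: continuous_on_subset)
  have F': "(F has_vector_derivative p w * q w) (at w)" if "0 < w" "w < 1" for w
    unfolding F_def using that p q
    by (intro indefinite_integral_deriv integrable_continuous_real)
      (auto intro!: continuous_intros elim: continuous_on_subset)
  have G: "((\<lambda>w. p w * exp (- H w)) has_derivative (\<lambda>h. 0)) (at w within {0..1})"
    if w: "w \<in> {0..1} - {0,1}" for w
  proof -
    have w': "0 < w" "w < 1" using w by auto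
    \<comment> \<open>So far \<open>p\<close> is only known to be continuous. The equation
      identifies it on the open interval with \<open>F w / w\<close>, a quotient that can be
      differentiated.\<close>
    have "((\<lambda>w. F w / w) has_vector_derivative p w * (q w - 1) / w) (at w)"
    proof -
      have "((\<lambda>w. F w * (complex_of_real (1/w))) has_vector_derivative
          F w * complex_of_real (- 1 / (w * w)) + p w * q w * complex_of_real (1/w)) (at w)"
        using w' by (intro has_vector_derivative_mult F' has_vector_derivative_of_real)
          (auto intro!: derivative_eq_intros simp: has_real_derivative_iff_has_vector_derivative[symmetric])
      moreover have "F w = w * p w" using eq[of w] w' by (simp add: F_def)
      ultimately show ?thesis using w' by (simp add: field_simps)
    qed
    then have p': "(p has_vector_derivative p w * (q w - 1) / w) (at w)"
      by (rule has_vector_derivative_transform_within_open[where S="{0<..<1}"])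
        (use w' in \<open>auto simp: F_def simp flip: eq\<close>)
    have "((\<lambda>w. exp (- H w)) has_vector_derivative (- ((q w - 1) / w)) * exp (- H w)) (at w)"
      using has_vector_derivative_minus[OF H'[OF w']]
      by (rule field_vector_diff_chain_at[unfolded o_def]) (rule DERIV_exp)
    from has_vector_derivative_mult[OF p' this]
    have "((\<lambda>w. p w * exp (- H w)) has_vector_derivative 0) (at w)"
      by (simp add: field_simps)
    then show ?thesis
      by (simp add: has_vector_derivative_def has_derivative_at_withinI)
  qed
  \<comment> \<open>The endpoints 0 and 1 are the exceptional points at which no derivative is
    required.\<close>
  have "p 1 * exp (- H 1) = 1"
    by (rule has_derivative_zero_unique_strong_interval[where k="{0,1}" and a=0 and b=1, OF _ _ _ G])
      (use p contH in \<open>auto intro!: continuous_intros simp: H_def\<close>)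
  then show ?thesis
    by (simp add: H_def exp_minus field_simps)
qed

text \<open>The function \<open>w * exp (H w)\<close> is an antiderivative of \<open>p * q\<close>:
  the product rule gives \<open>exp (H w)\<close> plus \<open>(q w - 1) * exp (H w)\<close>. The
  value at 1 suffices later, because the frequency \<open>z\<close> varies freely.\<close>

lemma exp_imp_mean_equation:
  fixes p q :: "real \<Rightarrow> complex"
  assumes q: "continuous_on {0..1} q"
    and k: "(\<lambda>w. (q w - 1) / w) integrable_on {0..1}"
    and p: "\<And>w. w \<in> {0..1} \<Longrightarrow> p w = exp (integral {0..w} (\<lambda>w. (q w - 1) / w))"
  shows "p 1 = integral {0..1} (\<lambda>v. p v * q v)"
proof -
  define H where "H w = integral {0..w} (\<lambda>w. (q w - 1) / w)" for w
  have contH: "continuous_on {0..1} H"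
    unfolding H_def by (rule indefinite_integral_continuous_1[OF k])
  have H': "(H has_vector_derivative (q w - 1) / w) (at w)" if "0 < w" "w < 1" for w
    unfolding H_def using that q
    by (intro indefinite_integral_deriv k) (auto intro!: continuous_intros elim: continuous_on_subset)
  have "((\<lambda>w. exp (H w) * q w) has_integral complex_of_real 1 * exp (H 1) - complex_of_real 0 * exp (H 0)) {0..1}"
  proof (rule fundamental_theorem_of_calculus_interior)
    show "continuous_on {0..1} (\<lambda>w. complex_of_real w * exp (H w))"
      by (intro continuous_intros contH)
    show "((\<lambda>w. complex_of_real w * exp (H w)) has_vector_derivative exp (H w) * q w) (at w)"
      if "w \<in> {0<..<1}" for w
    proof -
      have "((\<lambda>w. exp (H w)) has_vector_derivative ((q w - 1) / w) * exp (H w)) (at w)"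
        using H' that by (intro field_vector_diff_chain_at[unfolded o_def] DERIV_exp) auto
      from has_vector_derivative_mult[OF has_vector_derivative_of_real[OF DERIV_ident] this]
      show ?thesis using that by (simp add: field_simps)
    qed
  qed simp
  then have "integral {0..1} (\<lambda>w. exp (H w) * q w) = exp (H 1)"
    by (simp add: integral_unique)
  moreover have "integral {0..1} (\<lambda>w. exp (H w) * q w) = integral {0..1} (\<lambda>w. p w * q w)"
    by (intro integral_cong) (simp add: p H_def)
  ultimately show ?thesis by (simp add: p H_def)
qed

subsection \<open>The exponent of the limit law\<close>

text \<open>The majorant replaces \<open>min \<bar>a\<bar> (2 / r)\<close>, up to a factor of \<open>2\<close>, by a function with an
  elementary antiderivative.\<close>

lemma norm_levy_kernel_le:
  assumes "0 < r"
  shows "norm ((iexp (r * a) - 1) / complex_of_real r) \<le> 4 * \<bar>a\<bar> / (2 + \<bar>a\<bar> * r)"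
proof -
  have 1: "norm (iexp (r * a) - 1) \<le> r * \<bar>a\<bar>"
    using iexp_approx1[of "r * a" 0] assms by (simp add: abs_mult)
  have 2: "norm (iexp (r * a) - 1) \<le> 2"
    using norm_triangle_ineq4[of "iexp (r * a)" 1] by (simp del: of_real_mult)
  have "norm (iexp (r * a) - 1) * (2 + \<bar>a\<bar> * r) \<le> 4 * (\<bar>a\<bar> * r)"
  proof -
    have "norm (iexp (r * a) - 1) * 2 \<le> 2 * (\<bar>a\<bar> * r)"
      using 1 by (simp add: mult.commute)
    moreover have "norm (iexp (r * a) - 1) * (\<bar>a\<bar> * r) \<le> 2 * (\<bar>a\<bar> * r)"
      using 2 assms by (intro mult_right_mono) auto
    ultimately show ?thesis by (simp add: distrib_left)
  qed
  moreover have "2 + \<bar>a\<bar> * r > 0" using assms by (simp add: add_pos_nonneg)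
  ultimately show ?thesis
    using assms by (simp add: norm_divide divide_simps mult_ac)
qed

text \<open>The majorant has the antiderivative \<open>4 * ln (2 + \<bar>a\<bar> * r)\<close>. The
  resulting logarithmic growth in \<open>a\<close> is what the logarithmic moment can
  absorb.\<close>

lemma nn_integral_levy_kernel_le:
  "(\<integral>\<^sup>+r. norm (indicator {0<..<1::real} r *\<^sub>R ((iexp (r * a) - 1) / complex_of_real r)) \<partial>lborel)
    \<le> ennreal (4 * ln (1 + \<bar>a\<bar> / 2))"
proof -
  have pos: "2 + \<bar>a\<bar> * r > 0" if "0 \<le> r" for r using that by (simp add: add_pos_nonneg)
  have "(\<integral>\<^sup>+r. norm (indicator {0<..<1::real} r *\<^sub>R ((iexp (r * a) - 1) / complex_of_real r)) \<partial>lborel)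
      \<le> (\<integral>\<^sup>+r. ennreal (4 * \<bar>a\<bar> / (2 + \<bar>a\<bar> * r)) * indicator {0..1} r \<partial>lborel)"
    using norm_levy_kernel_le[of _ a] by (intro nn_integral_mono) (auto simp: indicator_def intro!: ennreal_leI)
  also have "\<dots> = ennreal (4 * ln (2 + \<bar>a\<bar> * 1) - 4 * ln (2 + \<bar>a\<bar> * 0))"
  proof (intro nn_integral_FTC_Icc)
    show "((\<lambda>r. 4 * ln (2 + \<bar>a\<bar> * r)) has_real_derivative 4 * \<bar>a\<bar> / (2 + \<bar>a\<bar> * r)) (at r)"
      if "r \<in> {0..1}" for r
      using pos[of r] that by (auto intro!: derivative_eq_intros)
    show "0 \<le> 4 * \<bar>a\<bar> / (2 + \<bar>a\<bar> * r)" if "r \<in> {0..1}" for r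
      using pos[of r] that by (intro divide_nonneg_pos) auto
  qed auto
  also have "4 * ln (2 + \<bar>a\<bar> * 1) - 4 * ln (2 + \<bar>a\<bar> * 0) = 4 * ln (1 + \<bar>a\<bar> / 2)"
    using ln_mult_pos[of 2 "1 + \<bar>a\<bar> / 2"] by (simp add: add_pos_nonneg)
  finally show ?thesis .
qed

text \<open>By Tonelli, the radial variable can be integrated first, and the logarithmic bound is
  then integrated against \<open>\<nu>\<close>. Joint integrability is what later permits exchanging
  the two integrals.\<close>

lemma integrable_levy_kernel:
  fixes \<nu> :: "'a::euclidean_space measure"
  assumes "finite_measure \<nu>" "sets \<nu> = sets borel" "log_moment \<nu>"
  shows "integrable (lborel \<Otimes>\<^sub>M \<nu>)
    (\<lambda>(r, y). indicator {0<..<1::real} r *\<^sub>R ((iexp (r * (z \<bullet> y)) - 1) / complex_of_real r))"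
    (is "integrable _ (case_prod ?k)")
proof (rule integrableI_bounded)
  interpret N: finite_measure \<nu> by fact
  interpret pair_sigma_finite lborel \<nu> ..
  note [measurable_cong] = assms(2)
  show [measurable]: "case_prod ?k \<in> borel_measurable (lborel \<Otimes>\<^sub>M \<nu>)"
    by measurable
  \<comment> \<open>The term \<open>ln 3\<close> covers \<open>ln (1 + norm y)\<close> when
    \<open>norm y \<le> 2\<close>; beyond that \<open>1 + norm y \<le> 3 * norm y\<close>, which
    adds \<open>ln (norm y)\<close>. The factor 4 comes from the majorant.\<close>
  let ?C = "4 * ln (1 + norm z) + 4 * ln 3"
  have bd: "ennreal (4 * ln (1 + \<bar>z \<bullet> y\<bar> / 2)) \<le> ennreal ?C + 4 * (ennreal (ln (norm y)) * indicator {x. norm x > 2} y)" for y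
  proof -
    have "1 + \<bar>z \<bullet> y\<bar> / 2 \<le> (1 + norm z) * (1 + norm y)"
      using Cauchy_Schwarz_ineq2[of z y] norm_ge_zero[of z] norm_ge_zero[of y]
      unfolding distrib_left distrib_right by linarith
    then have "ln (1 + \<bar>z \<bullet> y\<bar> / 2) \<le> ln ((1 + norm z) * (1 + norm y))"
      by (intro ln_mono) (auto simp: add_pos_nonneg)
    also have "\<dots> = ln (1 + norm z) + ln (1 + norm y)"
      by (intro ln_mult_pos) (auto simp: add_pos_nonneg)
    also have "ln (1 + norm y) \<le> ln 3 + ln (norm y) * indicator {x. norm x > 2} y"
    proof (cases "norm y > 2")
      case True
      have "ln (1 + norm y) \<le> ln (3 * norm y)"
        using True by (intro ln_mono) auto
      also have "\<dots> = ln 3 + ln (norm y)"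
        using True by (intro ln_mult_pos) auto
      finally show ?thesis using True by simp
    next
      case False
      then show ?thesis by (simp add: add_pos_nonneg)
    qed
    finally have "4 * ln (1 + \<bar>z \<bullet> y\<bar> / 2) \<le> ?C + 4 * (ln (norm y) * indicator {x. norm x > 2} y)"
      by simp
    then have "ennreal (4 * ln (1 + \<bar>z \<bullet> y\<bar> / 2)) \<le> ennreal (?C + 4 * (ln (norm y) * indicator {x. norm x > 2} y))"
      by (rule ennreal_leI)
    also have "\<dots> = ennreal ?C + 4 * (ennreal (ln (norm y)) * indicator {x. norm x > 2} y)"
      by (subst ennreal_plus) (auto simp: ennreal_mult' indicator_def)
    finally show ?thesis .
  qed
  have "(\<integral>\<^sup>+p. norm (case_prod ?k p) \<partial>(lborel \<Otimes>\<^sub>M \<nu>)) = (\<integral>\<^sup>+y. (\<integral>\<^sup>+r. norm (?k r y) \<partial>lborel) \<partial>\<nu>)"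
    using nn_integral_snd[of "\<lambda>p. ennreal (norm (case_prod ?k p))"] by simp
  also have "\<dots> \<le> (\<integral>\<^sup>+y. ennreal ?C + 4 * (ennreal (ln (norm y)) * indicator {x. norm x > 2} y) \<partial>\<nu>)"
    by (intro nn_integral_mono order_trans[OF nn_integral_levy_kernel_le bd])
  also have "\<dots> = ennreal ?C * emeasure \<nu> (space \<nu>) + 4 * (\<integral>\<^sup>+y\<in>{x. norm x > 2}. ennreal (ln (norm y)) \<partial>\<nu>)"
    by (subst nn_integral_add) (auto simp: nn_integral_cmult)
  also have "\<dots> < \<infinity>"
    using assms(3) by (simp add: log_moment_def ennreal_mult_eq_top_iff N.emeasure_finite less_top[symmetric] del: ennreal_plus)
  finally show "(\<integral>\<^sup>+p. norm (case_prod ?k p) \<partial>(lborel \<Otimes>\<^sub>M \<nu>)) < \<infinity>" .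
qed

text \<open>The exponent appearing in \<open>is_Lstar1\<close> at drift 0, named so that exponents
  of different measures can be compared.\<close>

definition levy_exponent :: "'a::euclidean_space measure \<Rightarrow> 'a \<Rightarrow> complex" where
  "levy_exponent \<nu> z = (CLINT y|\<nu>. (CLINT r:{0<..<1::real}|lborel.
     (iexp (r * (z \<bullet> y)) - 1) / complex_of_real r))"

text \<open>Fubini lets \<open>y\<close> be integrated first; as \<open>\<nu>\<close> has mass 1,
  this leaves its characteristic function minus 1, divided by \<open>r\<close>. The gauge-integral
  form on the closed interval fits the calculus along a ray.\<close>

lemma levy_exponent_has_integral:
  fixes \<nu> :: "'a::euclidean_space measure"
  assumes "prob_space \<nu>" and s: "sets \<nu> = sets borel" and "log_moment \<nu>"
  shows "((\<lambda>r. (char_fun \<nu> (r *\<^sub>R z) - 1) / complex_of_real r) has_integral levy_exponent \<nu> z) {0..1}"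
proof -
  interpret N: prob_space \<nu> by fact
  interpret pair_sigma_finite lborel \<nu> ..
  note [measurable_cong] = s
  let ?k = "\<lambda>r y. indicator {0<..<1::real} r *\<^sub>R ((iexp (r * (z \<bullet> y)) - 1) / complex_of_real r)"
  let ?g = "\<lambda>r. (char_fun \<nu> (r *\<^sub>R z) - 1) / complex_of_real r"
  have int: "integrable (lborel \<Otimes>\<^sub>M \<nu>) (case_prod ?k)"
    using assms N.finite_measure_axioms by (intro integrable_levy_kernel)
  have inner: "(CLINT y|\<nu>. ?k r y) = indicator {0<..<1} r *\<^sub>R ?g r" for r
  proof -
    have "integrable \<nu> (\<lambda>y. iexp (r * (z \<bullet> y)))"
      by (rule integrable_bounded_finite[OF N.finite_measure_axioms, where C=1]) (auto simp del: of_real_mult)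
    then show ?thesis by (simp add: char_fun_def N.prob_space)
  qed
  have I: "set_integrable lborel {0<..<1} ?g"
    using integrable_fst[OF int] unfolding inner set_integrable_def .
  have "levy_exponent \<nu> z = (CLINT r:{0<..<1}|lborel. ?g r)"
    unfolding levy_exponent_def set_lebesgue_integral_def inner[symmetric] integral_fst[OF int] integral_snd[OF int] ..
  also have "\<dots> = integral {0<..<1} ?g"
    by (rule set_borel_integral_eq_integral(2)[OF I])
  finally show ?thesis
    using set_borel_integral_eq_integral(1)[OF I]
    by (simp add: has_integral_iff integrable_on_open_interval_real integral_open_interval_real)
qed

section \<open>Characteristic function of the perpetuity\<close>

text \<open>Along a ray, \<open>char_fun\<close> is the one-dimensional characteristic function of
  the image under \<open>x \<mapsto> z \<bullet> x\<close>, which is continuous.\<close>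

lemma continuous_char_fun_ray:
  fixes \<nu> :: "'a::euclidean_space measure"
  assumes "prob_space \<nu>" "sets \<nu> = sets borel"
  shows "continuous_on A (\<lambda>t. char_fun \<nu> (t *\<^sub>R z))"
proof -
  interpret prob_space \<nu> by fact
  note [measurable_cong] = assms(2)
  interpret D: real_distribution "distr \<nu> borel (\<lambda>x. z \<bullet> x)"
    by (rule real_distribution_distr) measurable
  have "char_fun \<nu> (t *\<^sub>R z) = char (distr \<nu> borel (\<lambda>x. z \<bullet> x)) t" for t
    unfolding char_def char_fun_def by (subst integral_distr) auto
  then show ?thesis
    by (simp add: continuous_at_imp_continuous_on D.isCont_char)
qed

lemma char_fun_0: "prob_space \<nu> \<Longrightarrow> char_fun \<nu> 0 = 1"
  by (simp add: char_fun_def prob_space.prob_space)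

lemma continuous_on_powr_inverse:
  assumes "\<theta> > 0" "A \<subseteq> {0..}"
  shows "continuous_on A (\<lambda>w::real. w powr (1/\<theta>))"
  using assms by (intro continuous_on_powr' continuous_intros) auto

text \<open>For fixed \<open>u\<close> the scalar factor moves from the random vector to the
  frequency, and independence of \<open>X\<close> and \<open>Z\<close> splits the expectation into a
  product. Averaging over the uniform variable gives the integral over the unit interval.\<close>

lemma char_fun_perpetuity:
  fixes \<mu> \<nu> :: "'a::euclidean_space measure" and \<theta> :: real
  assumes "prob_space \<mu>" "prob_space \<nu>" and sets: "sets \<mu> = sets borel" "sets \<nu> = sets borel"
    and "\<theta> > 0"
  shows "char_fun (distr (uniform_measure lborel {0<..<1::real} \<Otimes>\<^sub>M (\<mu> \<Otimes>\<^sub>M \<nu>)) borel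
      (\<lambda>(u, x, z). (u powr (1 / \<theta>)) *\<^sub>R (x + z))) z =
    integral {0..1} (\<lambda>u. char_fun \<mu> (u powr (1/\<theta>) *\<^sub>R z) * char_fun \<nu> (u powr (1/\<theta>) *\<^sub>R z))"
proof -
  let ?U = "uniform_measure lborel {0<..<1::real}"
  interpret M: prob_space \<mu> by fact
  interpret N: prob_space \<nu> by fact
  interpret U: prob_space ?U by (rule prob_space_uniform_measure) auto
  interpret MN: pair_prob_space \<mu> \<nu> ..
  interpret UMN: pair_prob_space ?U "\<mu> \<Otimes>\<^sub>M \<nu>" ..
  note [measurable_cong] = sets
  let ?h = "\<lambda>u. char_fun \<mu> (u powr (1/\<theta>) *\<^sub>R z) * char_fun \<nu> (u powr (1/\<theta>) *\<^sub>R z)"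
  have conth: "continuous_on {0..1} ?h"
    using \<open>\<theta> > 0\<close>
    by (intro continuous_on_mult continuous_on_compose2[OF continuous_char_fun_ray[where A=UNIV]] assms
        continuous_on_powr_inverse) auto
  have inner: "(CLINT p|\<mu> \<Otimes>\<^sub>M \<nu>. iexp (v \<bullet> (fst p + snd p))) = char_fun \<mu> v * char_fun \<nu> v" for v
  proof -
    have "integrable (\<mu> \<Otimes>\<^sub>M \<nu>) (\<lambda>p. iexp (v \<bullet> (fst p + snd p)))"
      by (rule integrable_bounded_finite[OF MN.finite_measure_axioms, where C=1]) (auto simp del: of_real_add)
    then have "(CLINT p|\<mu> \<Otimes>\<^sub>M \<nu>. iexp (v \<bullet> (fst p + snd p))) = (CLINT x|\<mu>. CLINT y|\<nu>. iexp (v \<bullet> x) * iexp (v \<bullet> y))"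
      by (subst MN.integral_fst'[symmetric]) (simp_all add: inner_add_right exp_add[symmetric] ring_distribs)
    then show ?thesis by (simp add: char_fun_def)
  qed
  have "char_fun (distr (?U \<Otimes>\<^sub>M (\<mu> \<Otimes>\<^sub>M \<nu>)) borel (\<lambda>(u, x, z). (u powr (1 / \<theta>)) *\<^sub>R (x + z))) z =
     (CLINT p|?U \<Otimes>\<^sub>M (\<mu> \<Otimes>\<^sub>M \<nu>). iexp ((fst p powr (1/\<theta>) *\<^sub>R z) \<bullet> (fst (snd p) + snd (snd p))))"
    unfolding char_fun_def by (subst integral_distr) (auto simp: case_prod_beta)
  also have "\<dots> = (CLINT u|?U. ?h u)"
  proof -
    have "integrable (?U \<Otimes>\<^sub>M (\<mu> \<Otimes>\<^sub>M \<nu>)) (\<lambda>p. iexp ((fst p powr (1/\<theta>) *\<^sub>R z) \<bullet> (fst (snd p) + snd (snd p))))"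
      by (rule integrable_bounded_finite[OF UMN.finite_measure_axioms, where C=1]) (auto simp del: of_real_mult inner_scaleR_left)
    then show ?thesis
      by (subst UMN.integral_fst'[symmetric]) (simp_all add: inner del: inner_scaleR_left)
  qed
  also have "\<dots> = (CLINT u:{0<..<1}|lborel. ?h u)"
  proof -
    have "?h \<in> borel_measurable borel"
      by (intro borel_measurable_times measurable_compose[OF _ borel_measurable_continuous_onI[OF continuous_char_fun_ray]] assms)
        measurable
    then show ?thesis
      unfolding uniform_measure_def set_lebesgue_integral_def
      by (subst integral_density[where g="indicator {0<..<1}", symmetric])
        (auto simp: divide_ennreal_def  ennreal_indicator)
  qed
  also have "\<dots> = integral {0<..<1} ?h"
  proof (rule set_borel_integral_eq_integral(2))
    have "set_integrable lborel {0..1} ?h"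
      unfolding set_integrable_def by (rule borel_integrable_compact[OF _ conth]) simp
    then show "set_integrable lborel {0<..<1} ?h"
      by (rule set_integrable_subset) auto
  qed
  finally show ?thesis by (simp add: integral_open_interval_real)
qed

section \<open>From the fixed-point equation to the exponent and back\<close>

text \<open>Under \<open>s = w powr (1/\<theta>)\<close> one has
  \<open>ds / s = dw / (\<theta> * w)\<close>, whence the factor \<open>\<theta>\<close>. The
  fundamental theorem with interior derivatives copes with the singularity at 0 and also yields
  integrability of the substituted kernel.\<close>

lemma has_integral_levy_power_substitution:
  fixes g :: "real \<Rightarrow> complex" and \<theta> :: real
  assumes "\<theta> > 0" and g: "continuous_on {0..1} g"
    and k: "(\<lambda>s. (g s - 1) / s) integrable_on {0..1}" and w: "0 \<le> w" "w \<le> 1"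
  shows "((\<lambda>w. (g (w powr (1/\<theta>)) - 1) / w) has_integral
    \<theta> * integral {0..w powr (1/\<theta>)} (\<lambda>s. (g s - 1) / s)) {0..w}"
proof -
  define I where "I t = integral {0..t} (\<lambda>s. (g s - 1) / s)" for t
  have contI: "continuous_on {0..1} I"
    unfolding I_def by (rule indefinite_integral_continuous_1[OF k])
  have "((\<lambda>w. (g (w powr (1/\<theta>)) - 1) / w) has_integral
    \<theta> * I (w powr (1/\<theta>)) - \<theta> * I (0 powr (1/\<theta>))) {0..w}"
  proof (rule fundamental_theorem_of_calculus_interior)
    show "continuous_on {0..w} (\<lambda>w. complex_of_real \<theta> * I (w powr (1/\<theta>)))"
      using assms
      by (intro continuous_on_mult continuous_on_const continuous_on_compose2[OF contI] continuous_on_powr_inverse)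
        (auto intro!: powr_le1)
    show "((\<lambda>w. complex_of_real \<theta> * I (w powr (1/\<theta>))) has_vector_derivative
        (g (v powr (1/\<theta>)) - 1) / v) (at v)" if "v \<in> {0<..<w}" for v
    proof -
      have v: "0 < v" "v < 1" using that w by auto
      have pv: "0 < v powr (1/\<theta>)" "v powr (1/\<theta>) < 1"
        using v \<open>\<theta> > 0\<close> powr_less_mono2[of "1/\<theta>" v 1] by auto
      have "(I has_vector_derivative (g (v powr (1/\<theta>)) - 1) / (v powr (1/\<theta>))) (at (v powr (1/\<theta>)))"
        unfolding I_def using pv g
        by (intro indefinite_integral_deriv k) (auto intro!: continuous_intros elim: continuous_on_subset)
      moreover have "((\<lambda>w. w powr (1/\<theta>)) has_vector_derivative v powr (1/\<theta>) / (\<theta> * v)) (at v)"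
        using v \<open>\<theta> > 0\<close> unfolding has_real_derivative_iff_has_vector_derivative[symmetric]
        by (auto intro!: derivative_eq_intros simp: powr_diff)
      ultimately have "((\<lambda>w. I (w powr (1/\<theta>))) has_vector_derivative
          (v powr (1/\<theta>) / (\<theta> * v)) *\<^sub>R ((g (v powr (1/\<theta>)) - 1) / (v powr (1/\<theta>)))) (at v)"
        using vector_diff_chain_at[of "\<lambda>w. w powr (1/\<theta>)" _ v I] by (simp add: o_def)
      from has_vector_derivative_mult_right[OF this, of "complex_of_real \<theta>"]
      moreover have "complex_of_real \<theta> * ((v powr (1/\<theta>) / (\<theta> * v)) *\<^sub>R
          ((g (v powr (1/\<theta>)) - 1) / (v powr (1/\<theta>)))) = (g (v powr (1/\<theta>)) - 1) / v"
        using v pv \<open>\<theta> > 0\<close> by (simp add: scaleR_conv_of_real)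
      ultimately show ?thesis by (simp only:)
    qed
  qed (use w in auto)
  then show ?thesis by (simp add: I_def)
qed

text \<open>For each \<open>z\<close>, the equation between laws becomes the mean equation for
  \<open>p z\<close> and \<open>q z\<close>, which is solved by an exponential. Conversely the
  exponential solves the mean equation, and Fourier uniqueness lifts this back to the laws.\<close>

lemma perpetuity_iff_char_fun:
  fixes \<mu> \<nu> :: "'a::euclidean_space measure" and \<theta> :: real
  assumes prob: "prob_space \<mu>" "prob_space \<nu>" and sets: "sets \<mu> = sets borel" "sets \<nu> = sets borel"
    and "log_moment \<nu>" and \<theta>: "\<theta> > 0"
  shows "\<mu> = distr (uniform_measure lborel {0<..<1::real} \<Otimes>\<^sub>M (\<mu> \<Otimes>\<^sub>M \<nu>)) borel
      (\<lambda>(u, x, z). (u powr (1 / \<theta>)) *\<^sub>R (x + z)) \<longleftrightarrow>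
    (\<forall>z. char_fun \<mu> z = exp (\<theta> * levy_exponent \<nu> z))" (is "\<mu> = ?D \<longleftrightarrow> _")
proof -
  define f where "f z t = char_fun \<mu> (t *\<^sub>R z)" for z t
  define g where "g z t = char_fun \<nu> (t *\<^sub>R z)" for z t
  define p where "p z w = f z (w powr (1/\<theta>))" for z w
  define q where "q z w = g z (w powr (1/\<theta>))" for z w
  have cont: "continuous_on A (f z)" "continuous_on A (g z)" for A z
    unfolding f_def g_def using assms by (auto intro!: continuous_char_fun_ray)
  have contp: "continuous_on {0..1} (p z)" and contq: "continuous_on {0..1} (q z)" for z
    unfolding p_def q_def using \<theta>
    by (auto intro!: continuous_on_compose2[OF cont(1)[of UNIV]] continuous_on_compose2[OF cont(2)[of UNIV]] continuous_on_powr_inverse)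
  have kernel: "((\<lambda>s. (g z s - 1) / s) has_integral levy_exponent \<nu> z) {0..1}" for z
    unfolding g_def using assms by (intro levy_exponent_has_integral)
  have subst: "((\<lambda>w. (q z w - 1) / w) has_integral
      \<theta> * integral {0..w powr (1/\<theta>)} (\<lambda>s. (g z s - 1) / s)) {0..w}" if "0 \<le> w" "w \<le> 1" for z w
    unfolding q_def using that
    by (intro has_integral_levy_power_substitution \<theta> cont has_integral_integrable[OF kernel])
  have charD: "char_fun ?D z = integral {0..1} (\<lambda>u. p z u * q z u)" for z
    unfolding p_def q_def f_def g_def using assms by (intro char_fun_perpetuity)
  \<comment> \<open>Since \<open>0 powr (1/\<theta>) = 0\<close>, the value at \<open>w = 0\<close>
    is the characteristic function at frequency 0.\<close>
  have p0: "p z 0 = 1" and p1: "p z 1 = char_fun \<mu> z" for z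
    using prob by (simp_all add: p_def f_def char_fun_0)
  show ?thesis
  proof (intro iffI allI)
    fix z assume D: "\<mu> = ?D"
    have "p z 1 = exp (integral {0..1} (\<lambda>w. (q z w - 1) / w))"
    proof (rule mean_equation_imp_exp[OF contp p0 contq])
      show "(\<lambda>w. (q z w - 1) / w) integrable_on {0..1}"
        using subst[of 1 z] by auto
      fix w :: real assume w: "0 < w" "w \<le> 1"
      \<comment> \<open>The fixed-point equation is used at the frequency
        \<open>w powr (1/\<theta>) *\<^sub>R z\<close>. Multiplicativity of \<open>powr\<close>
        merges \<open>w\<close> and \<open>u\<close> into \<open>w * u\<close>, and stretching the
        interval gives the mean over \<open>{0..w}\<close>.\<close>
      have "p z w = char_fun ?D (w powr (1/\<theta>) *\<^sub>R z)"
        unfolding p_def f_def using D by simp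
      also have "\<dots> = integral {0..1} (\<lambda>u. p z (w * u) * q z (w * u))"
        unfolding charD using w by (intro integral_cong) (simp add: p_def q_def f_def g_def powr_mult mult.commute)
      also have "\<dots> = integral {0..w} (\<lambda>v. p z v * q z v) / w"
      proof -
        have "(\<lambda>v. p z v * q z v) integrable_on {0..w}"
          using w by (intro integrable_continuous_real continuous_intros continuous_on_subset[OF contp] continuous_on_subset[OF contq]) auto
        from has_integral_stretch_real[OF integrable_integral[OF this], of w]
        show ?thesis using w by (simp add: integral_unique scaleR_conv_of_real image_divide_atLeastAtMost)
      qed
      finally show "w * p z w = integral {0..w} (\<lambda>v. p z v * q z v)" using w by simp
    qed
    also have "integral {0..1} (\<lambda>w. (q z w - 1) / w) = \<theta> * levy_exponent \<nu> z"
      using subst[of 1 z] kernel[of z] by (simp add: integral_unique)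
    finally show "char_fun \<mu> z = exp (\<theta> * levy_exponent \<nu> z)" by (simp add: p1)
  next
    assume C: "\<forall>z. char_fun \<mu> z = exp (\<theta> * levy_exponent \<nu> z)"
    \<comment> \<open>The hypothesis is applied at \<open>t *\<^sub>R z\<close>. Because
      \<open>dr / r\<close> is invariant under scaling, the exponent there is the kernel integral
      for \<open>z\<close> cut off at \<open>t\<close>. The case \<open>w = 0\<close> is separate,
      as stretching by \<open>t = 0\<close> is impossible.\<close>
    have pw: "p z w = exp (integral {0..w} (\<lambda>w. (q z w - 1) / w))" if w: "w \<in> {0..1}" for z w
    proof (cases "w = 0")
      case True
      then show ?thesis by (simp add: p0)
    next
      case False
      define t where "t = w powr (1/\<theta>)"
      have t: "0 < t" "t \<le> 1" using w False \<theta> by (auto simp: t_def powr_le1)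
      have "(\<lambda>s. (g z s - 1) / s) integrable_on {0..t}"
        using kernel[of z] t by (auto intro: integrable_on_subinterval)
      from has_integral_stretch_real[OF integrable_integral[OF this], of t]
      have "((\<lambda>s. (g z (t * s) - 1) / (t * s)) has_integral integral {0..t} (\<lambda>s. (g z s - 1) / s) / t) {0..1}"
        using t by (simp add: scaleR_conv_of_real image_divide_atLeastAtMost)
      from has_integral_mult_right[OF this, of "complex_of_real t"]
      have "((\<lambda>s. (g (t *\<^sub>R z) s - 1) / s) has_integral integral {0..t} (\<lambda>s. (g z s - 1) / s)) {0..1}"
        using t by (simp add: g_def mult.commute)
      then have "levy_exponent \<nu> (t *\<^sub>R z) = integral {0..t} (\<lambda>s. (g z s - 1) / s)"
        using kernel[of "t *\<^sub>R z"] by (rule has_integral_unique[rotated])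
      then have "p z w = exp (\<theta> * integral {0..t} (\<lambda>s. (g z s - 1) / s))"
        using C by (simp add: p_def f_def t_def)
      then show ?thesis
        using subst[of w z] w by (simp add: t_def integral_unique)
    qed
    have "char_fun \<mu> z = char_fun ?D z" for z
    proof -
      have "p z 1 = integral {0..1} (\<lambda>v. p z v * q z v)"
        using subst[of 1 z] by (intro exp_imp_mean_equation contq pw) auto
      then show ?thesis by (simp add: p1 charD)
    qed
    moreover have "finite_measure ?D"
    proof -
      interpret M: prob_space \<mu> by fact
      interpret N: prob_space \<nu> by fact
      interpret U: prob_space "uniform_measure lborel {0<..<1::real}" by (rule prob_space_uniform_measure) auto
      interpret MN: pair_prob_space \<mu> \<nu> ..
      interpret UMN: pair_prob_space "uniform_measure lborel {0<..<1::real}" "\<mu> \<Otimes>\<^sub>M \<nu>" ..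
      note [measurable_cong] = sets
      show ?thesis by (rule UMN.finite_measure_distr) measurable
    qed
    ultimately show "\<mu> = ?D"
      using prob sets by (intro char_fun_unique) (auto simp: prob_space_def)
  qed
qed

subsection \<open>The characterization\<close>

text \<open>A general weight serves both changes of measure below: scaling while removing the atom
  at 0, and normalising to mass 1.\<close>

lemma levy_exponent_density:
  fixes \<nu> :: "'a::euclidean_space measure"
  assumes "sets \<nu> = sets borel" and [measurable]: "c \<in> borel_measurable borel" and "\<And>y. 0 \<le> c y"
  shows "levy_exponent (density \<nu> (\<lambda>y. ennreal (c y))) z = (CLINT y|\<nu>. c y *\<^sub>R (CLINT r:{0<..<1::real}|lborel.
     (iexp (r * (z \<bullet> y)) - 1) / complex_of_real r))"
proof -
  note [measurable_cong] = assms(1)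
  show ?thesis
    unfolding levy_exponent_def set_lebesgue_integral_def
    using assms(3) by (intro integral_density) auto
qed

lemma log_moment_density_const:
  assumes "sets \<nu> = sets borel" "log_moment \<nu>"
  shows "log_moment (density \<nu> (\<lambda>_. ennreal c))"
proof -
  note [measurable_cong] = assms(1)
  show ?thesis
    using assms(2) unfolding log_moment_def
    by (simp add: nn_integral_density nn_integral_cmult ennreal_mult_less_top)
qed

text \<open>The two measures are linked only through their exponents, so \<open>\<nu>\<close> and
  \<open>\<theta>\<close> times \<open>\<nu>\<^sub>1\<close> may still differ by an atom at
  0.\<close>

lemma perpetuity_iff_is_Lstar1:
  fixes \<mu> \<nu> \<nu>\<^sub>1 :: "'a::euclidean_space measure" and \<theta> :: real
  assumes "prob_space \<mu>" "sets \<mu> = sets borel" "prob_space \<nu>\<^sub>1" "sets \<nu>\<^sub>1 = sets borel" "log_moment \<nu>\<^sub>1" "\<theta> > 0"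
    and "\<And>z. levy_exponent \<nu> z = \<theta> * levy_exponent \<nu>\<^sub>1 z"
  shows "\<mu> = distr (uniform_measure lborel {0<..<1::real} \<Otimes>\<^sub>M (\<mu> \<Otimes>\<^sub>M \<nu>\<^sub>1)) borel
      (\<lambda>(u, x, z). (u powr (1 / \<theta>)) *\<^sub>R (x + z)) \<longleftrightarrow> is_Lstar1 \<nu> 0 \<mu>"
  using perpetuity_iff_char_fun[OF assms(1,3,2,4,5,6)] assms
  by (simp add: is_Lstar1_def borel_measure_def levy_exponent_def)

theorem theorem4:
  fixes \<mu> :: "'a::euclidean_space measure"
  assumes "prob_space \<mu>" and "borel_measure \<mu>"
  shows "MVP \<mu> \<longleftrightarrow>
    (\<exists>\<nu> :: 'a measure.
       finite_measure \<nu> \<and> borel_measure \<nu> \<and> emeasure \<nu> {0} = 0 \<and> log_moment \<nu> \<and>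
       is_Lstar1 \<nu> 0 \<mu>)"
proof -
  have s\<mu>: "sets \<mu> = sets borel" using assms(2) by (simp add: borel_measure_def)
  show ?thesis
  proof
    assume "MVP \<mu>"
    then obtain \<theta> and \<nu>\<^sub>1 :: "'a measure" where \<theta>: "\<theta> > 0" and \<nu>\<^sub>1: "prob_space \<nu>\<^sub>1" "log_moment \<nu>\<^sub>1"
      and s: "sets \<nu>\<^sub>1 = sets borel"
      and D: "\<mu> = distr (uniform_measure lborel {0<..<1::real} \<Otimes>\<^sub>M (\<mu> \<Otimes>\<^sub>M \<nu>\<^sub>1)) borel
              (\<lambda>(u, x, z). (u powr (1 / \<theta>)) *\<^sub>R (x + z))"
      by (auto simp: MVP_def borel_measure_def)
    interpret N: prob_space \<nu>\<^sub>1 by fact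
    note [measurable_cong] = s
    \<comment> \<open>The factor \<open>\<theta>\<close> is the one in front of the exponent; the
      indicator cuts out a possible atom of \<open>\<nu>\<^sub>1\<close> at 0.\<close>
    define \<nu> where "\<nu> = density \<nu>\<^sub>1 (\<lambda>y. ennreal (\<theta> * indicator (- {0}) y))"
    have le: "ennreal (\<theta> * indicator (- {0}) y) \<le> ennreal \<theta>" for y :: 'a
      using \<theta> by (intro ennreal_leI) (auto simp: indicator_def)
    have "emeasure \<nu> (space \<nu>) \<le> (\<integral>\<^sup>+y. ennreal \<theta> \<partial>\<nu>\<^sub>1)"
      unfolding \<nu>_def by (subst emeasure_density) (auto intro!: nn_integral_mono le simp del: nn_integral_const)
    then have fin: "finite_measure \<nu>"
      by (intro finite_measureI) (auto simp: N.emeasure_space_1 top_unique)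
    have null: "emeasure \<nu> {0} = 0"
    proof -
      have "emeasure \<nu> {0} = (\<integral>\<^sup>+y. ennreal (\<theta> * indicator (- {0}) y) * indicator {0} y \<partial>\<nu>\<^sub>1)"
        unfolding \<nu>_def using s by (intro emeasure_density) auto
      also have "\<dots> = (\<integral>\<^sup>+y. 0 \<partial>\<nu>\<^sub>1)"
        by (intro nn_integral_cong) (auto simp: indicator_def)
      finally show ?thesis by simp
    qed
    have log: "log_moment \<nu>"
    proof -
      have "(\<integral>\<^sup>+x\<in>{x. norm x > 2}. ennreal (ln (norm x)) \<partial>\<nu>) \<le>
          (\<integral>\<^sup>+x\<in>{x. norm x > 2}. ennreal (ln (norm x)) \<partial>(density \<nu>\<^sub>1 (\<lambda>_. ennreal \<theta>)))"
        unfolding \<nu>_def by (subst (1 2) nn_integral_density) (auto intro!: nn_integral_mono mult_right_mono le)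
      then show ?thesis
        using log_moment_density_const[OF s \<nu>\<^sub>1(2), of \<theta>] unfolding log_moment_def by (rule le_less_trans)
    qed
    \<comment> \<open>Cutting out the origin does not change the exponent, since
      \<open>iexp (r * (z \<bullet> y)) - 1\<close> vanishes at \<open>y = 0\<close>.\<close>
    have "levy_exponent \<nu> z = \<theta> * levy_exponent \<nu>\<^sub>1 z" for z
      unfolding \<nu>_def using \<theta> s
      by (subst levy_exponent_density)
        (auto simp: levy_exponent_def indicator_def scaleR_conv_of_real simp flip: integral_mult_right_zero
          intro!: Bochner_Integration.integral_cong)
    then have "is_Lstar1 \<nu> 0 \<mu>"
      using perpetuity_iff_is_Lstar1[OF assms(1) s\<mu> \<nu>\<^sub>1(1) s \<nu>\<^sub>1(2) \<theta>] D by blast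
    then show "\<exists>\<nu> :: 'a measure. finite_measure \<nu> \<and> borel_measure \<nu> \<and> emeasure \<nu> {0} = 0 \<and> log_moment \<nu> \<and>
         is_Lstar1 \<nu> 0 \<mu>"
      using fin null log s by (intro exI[of _ \<nu>]) (auto simp: borel_measure_def \<nu>_def)
  next
    assume "\<exists>\<nu> :: 'a measure. finite_measure \<nu> \<and> borel_measure \<nu> \<and> emeasure \<nu> {0} = 0 \<and> log_moment \<nu> \<and>
         is_Lstar1 \<nu> 0 \<mu>"
    then obtain \<nu> :: "'a measure" where fin: "finite_measure \<nu>" and s: "sets \<nu> = sets borel"
      and log: "log_moment \<nu>" and L: "is_Lstar1 \<nu> 0 \<mu>"
      by (auto simp: borel_measure_def)
    interpret N: finite_measure \<nu> by fact
    define m where "m = measure \<nu> (space \<nu>)"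
    have "\<exists>\<theta>. (0::real) < \<theta> \<and> (\<exists>\<nu>\<^sub>1 :: 'a measure. prob_space \<nu>\<^sub>1 \<and> sets \<nu>\<^sub>1 = sets borel \<and> log_moment \<nu>\<^sub>1 \<and>
        (\<forall>z. levy_exponent \<nu> z = \<theta> * levy_exponent \<nu>\<^sub>1 z))"
    proof (cases "m = 0")
      \<comment> \<open>The zero measure cannot be normalised. Its exponent is 0, as is that of the
        point mass at 0, so \<open>Z = 0\<close> with \<open>\<theta> = 1\<close> serves as
        witness.\<close>
      case True
      then have "emeasure \<nu> (space \<nu>) = 0" by (simp add: m_def N.emeasure_eq_measure)
      then have "levy_exponent \<nu> z = 0" for z
        unfolding levy_exponent_def by (intro integral_eq_zero_AE AE_I[where N="space \<nu>"]) auto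
      moreover have "levy_exponent (return borel (0::'a)) z = 0" for z
        by (simp add: levy_exponent_def set_lebesgue_integral_def integral_return)
      moreover have "log_moment (return borel (0::'a))"
        by (simp add: log_moment_def nn_integral_return)
      ultimately show ?thesis
        by (intro exI[of _ "1::real"] conjI exI[of _ "return borel 0"]) (auto intro: prob_space_return)
    next
      case False
      then have m: "m > 0" by (simp add: m_def zero_less_measure_iff)
      \<comment> \<open>The total mass \<open>m\<close> becomes the parameter
        \<open>\<theta>\<close>, and the normalised measure becomes the law of
        \<open>Z\<close>.\<close>
      let ?N = "density \<nu> (\<lambda>_. ennreal (1/m))"
      have "emeasure ?N (space ?N) = 1"
        using m by (simp add: emeasure_density_const N.emeasure_eq_measure ennreal_mult'[symmetric] flip: m_def)
      then have "prob_space ?N" by (rule prob_spaceI)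
      moreover have "levy_exponent \<nu> z = m * levy_exponent ?N z" for z
        using m s by (subst levy_exponent_density) (auto simp: levy_exponent_def scaleR_conv_of_real)
      ultimately show ?thesis
        using m s log_moment_density_const[OF s log] by (intro exI[of _ m] conjI exI[of _ ?N]) auto
    qed
    then show "MVP \<mu>"
      using L assms(1) s\<mu> perpetuity_iff_is_Lstar1[OF assms(1) s\<mu>, of _ _ \<nu>]
      unfolding MVP_def borel_measure_def by blast
  qed
qed

end
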